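(* For all integers $m\ge 2$ and all path-connected ANR spaces $X$ and $Y$, $\max\{\mathsf{iTC}_m(X),\mathsf{iTC}_m(Y)\}\le\min\{\mathsf{iTC}_m(X\vee Y),\mathsf{iTC}_m(X\times Y)\}$.
   Context: $X\vee Y$ is the wedge with respect to chosen basepoints. $I=[0,1]$. For a metric space $Z$ and $n\ge 1$, $\mathcal B_n(Z)$ is the space of probability measures on $Z$ whose support has at most $n$ points, written as finite formal convex combinations $\sum\lambda_z z$ with $\lambda_z>0$, $\sum\lambda_z=1$, equipped with the Lévy–Prokhorov metric; $\delta_z$ is the Dirac measure at $z$. $P(Z)$ is the space of continuous paths $I\to Z$ with the compact-open topology. Define $\Phi_n:\mathcal B_n(P(X))\to P(\mathcal B_n(X))$ by $\Phi_n(\sum\lambda_\alpha\alpha)(t)=\sum\lambda_\alpha\alpha(t)$. A path $f\in P(\mathcal B_n(X))$ is resolvable if $f=\Phi_n(\mu)$ for some $\mu\in\mathcal B_n(P(X))$; $RP(\mathcal B_n(X))\subset P(\mathcal B_n(X))$ is the subspace of resolvable paths. For $m\ge2$ let $t_i=(i-1)/(m-1)$, $1\le i\le m$. $\mathsf{iTC}_m(X)$ is the minimal integer $n\ge 0$ such that there is a continuous map $s_m:X^m\to RP(\mathcal B_{n+1}(X))$ with $s_m(x_1,\dots,x_m)(t_i)=\delta_{x_i}$ for all $1\le i\le m$ and all $(x_1,\dots,x_m)\in X^m$ (infinite if no such $n$ exists). *)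

theory Defs
  imports "HOL-Probability.Probability_Mass_Function" "HOL-Library.Extended_Nat"
begin

section \<open>Absolute neighbourhood retracts\<close>

text \<open>
  ANRs for the class of metrizable spaces. A definition cannot quantify over the types of the
  ambient spaces \<open>Z\<close>, so these live on the type \<open>'a \<Rightarrow> real\<close>, which is large enough: by the
  Kuratowski--Wojdyslawski theorem \<open>X\<close> is homeomorphic to a closed subset of a convex subset of
  the normed space of bounded real functions on \<open>X\<close>, and by Dugundji's extension theorem a
  neighbourhood retract of such a convex set is an ANR in the unrestricted sense.
\<close>

definition ANR_space :: "'a topology \<Rightarrow> bool" where
  "ANR_space X \<longleftrightarrow> metrizable_space X \<and>
     (\<forall>(Z :: ('a \<Rightarrow> real) topology) S.
        metrizable_space Z \<and> closedin Z S \<and> X homeomorphic_space subtopology Z S \<longrightarrow>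
        (\<exists>U. openin Z U \<and> S \<subseteq> U \<and> S retract_of_space subtopology Z U))"

section \<open>Wedge of two pointed spaces\<close>

text \<open>
  The quotient of the disjoint union that identifies \<open>x0\<close> and \<open>y0\<close>, with \<open>Inl x0\<close> as the
  representative of the common base point and every other class represented by its element.
\<close>

definition wedge_inr :: "'a \<Rightarrow> 'b \<Rightarrow> 'b \<Rightarrow> 'a + 'b" where
  "wedge_inr x0 y0 y = (if y = y0 then Inl x0 else Inr y)"

definition wedge_topology :: "'a topology \<Rightarrow> 'a \<Rightarrow> 'b topology \<Rightarrow> 'b \<Rightarrow> ('a + 'b) topology" where
  "wedge_topology X x0 Y y0 = topology (\<lambda>U.
     U \<subseteq> Inl ` topspace X \<union> wedge_inr x0 y0 ` topspace Y \<and>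
     openin X {x \<in> topspace X. Inl x \<in> U} \<and>
     openin Y {y \<in> topspace Y. wedge_inr x0 y0 y \<in> U})"

lemma openin_wedge_topology:
  "openin (wedge_topology X x0 Y y0) U \<longleftrightarrow>
     U \<subseteq> Inl ` topspace X \<union> wedge_inr x0 y0 ` topspace Y \<and>
     openin X {x \<in> topspace X. Inl x \<in> U} \<and>
     openin Y {y \<in> topspace Y. wedge_inr x0 y0 y \<in> U}"
proof -
  let ?P = "\<lambda>U. U \<subseteq> Inl ` topspace X \<union> wedge_inr x0 y0 ` topspace Y \<and>
     openin X {x \<in> topspace X. Inl x \<in> U} \<and>
     openin Y {y \<in> topspace Y. wedge_inr x0 y0 y \<in> U}"
  have "istopology ?P"
    unfolding istopology_def
  proof (intro conjI allI impI)
    fix S T assume S: "?P S" and T: "?P T"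
    have eq: "{x \<in> topspace X. Inl x \<in> S \<inter> T}
        = {x \<in> topspace X. Inl x \<in> S} \<inter> {x \<in> topspace X. Inl x \<in> T}"
      "{y \<in> topspace Y. wedge_inr x0 y0 y \<in> S \<inter> T}
        = {y \<in> topspace Y. wedge_inr x0 y0 y \<in> S} \<inter> {y \<in> topspace Y. wedge_inr x0 y0 y \<in> T}"
      by auto
    show "S \<inter> T \<subseteq> Inl ` topspace X \<union> wedge_inr x0 y0 ` topspace Y" using S by blast
    show "openin X {x \<in> topspace X. Inl x \<in> S \<inter> T}"
      unfolding eq using S T by blast
    show "openin Y {y \<in> topspace Y. wedge_inr x0 y0 y \<in> S \<inter> T}"
      unfolding eq using S T by blast
  next
    fix K assume K: "\<forall>S\<in>K. ?P S"
    have eq: "{x \<in> topspace X. Inl x \<in> \<Union>K} = (\<Union>S\<in>K. {x \<in> topspace X. Inl x \<in> S})"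
      "{y \<in> topspace Y. wedge_inr x0 y0 y \<in> \<Union>K}
        = (\<Union>S\<in>K. {y \<in> topspace Y. wedge_inr x0 y0 y \<in> S})"
      by auto
    show "\<Union>K \<subseteq> Inl ` topspace X \<union> wedge_inr x0 y0 ` topspace Y" using K by blast
    show "openin X {x \<in> topspace X. Inl x \<in> \<Union>K}"
      unfolding eq using K by (intro openin_Union) auto
    show "openin Y {y \<in> topspace Y. wedge_inr x0 y0 y \<in> \<Union>K}"
      unfolding eq using K by (intro openin_Union) auto
  qed
  then show ?thesis
    by (simp add: wedge_topology_def topology_inverse')
qed

lemma topspace_wedge_topology:
  "topspace (wedge_topology X x0 Y y0) = Inl ` topspace X \<union> wedge_inr x0 y0 ` topspace Y"
proof
  show "topspace (wedge_topology X x0 Y y0) \<subseteq> Inl ` topspace X \<union> wedge_inr x0 y0 ` topspace Y"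
    using openin_wedge_topology openin_topspace by metis
  have "openin (wedge_topology X x0 Y y0) (Inl ` topspace X \<union> wedge_inr x0 y0 ` topspace Y)"
    unfolding openin_wedge_topology
  proof (intro conjI)
    have "{x \<in> topspace X. Inl x \<in> Inl ` topspace X \<union> wedge_inr x0 y0 ` topspace Y} = topspace X"
      by auto
    then show "openin X {x \<in> topspace X. Inl x \<in> Inl ` topspace X \<union> wedge_inr x0 y0 ` topspace Y}"
      by simp
    have "{y \<in> topspace Y. wedge_inr x0 y0 y \<in> Inl ` topspace X \<union> wedge_inr x0 y0 ` topspace Y}
        = topspace Y"
      by auto
    then show "openin Y {y \<in> topspace Y. wedge_inr x0 y0 y
        \<in> Inl ` topspace X \<union> wedge_inr x0 y0 ` topspace Y}"
      by simp
  qed simp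
  then show "Inl ` topspace X \<union> wedge_inr x0 y0 ` topspace Y \<subseteq> topspace (wedge_topology X x0 Y y0)"
    by (rule openin_subset)
qed

text \<open>In particular, the wedge of two metric spaces is induced by some metric.\<close>

lemma metrizable_space_wedge_topology:
  assumes "metrizable_space X" "metrizable_space Y" and x0: "x0 \<in> topspace X" and y0: "y0 \<in> topspace Y"
  shows "metrizable_space (wedge_topology X x0 Y y0)"
proof -
  let ?W = "wedge_topology X x0 Y y0" and ?P = "prod_topology X Y"
  define h where "h = case_sum (\<lambda>x. (x, y0)) (\<lambda>y. (x0, y))"
  have h_inl: "h (Inl x) = (x, y0)" and h_inr: "h (wedge_inr x0 y0 y) = (x0, y)" for x y
    by (auto simp: h_def wedge_inr_def)
  have clX: "closedin X {x0}" and clY: "closedin Y {y0}"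
    using closedin_Hausdorff_singleton[OF metrizable_imp_Hausdorff_space] assms by metis+
  have cont: "continuous_map ?W ?P h"
    unfolding continuous_map_def
  proof (intro conjI allI impI)
    show "h \<in> topspace ?W \<rightarrow> topspace ?P"
      using x0 y0 by (auto simp: topspace_wedge_topology h_inl h_inr)
  next
    fix V assume V: "openin ?P V"
    have 1: "continuous_map X ?P (\<lambda>x. (x, y0))" and 2: "continuous_map Y ?P (\<lambda>y. (x0, y))"
      using x0 y0 by (auto intro!: continuous_map_pairedI)
    have eq: "{x \<in> topspace X. Inl x \<in> {w \<in> topspace ?W. h w \<in> V}} = {x \<in> topspace X. (x, y0) \<in> V}"
      "{y \<in> topspace Y. wedge_inr x0 y0 y \<in> {w \<in> topspace ?W. h w \<in> V}}
        = {y \<in> topspace Y. (x0, y) \<in> V}"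
      by (auto simp: topspace_wedge_topology h_inl h_inr)
    have "{w \<in> topspace ?W. h w \<in> V} \<subseteq> Inl ` topspace X \<union> wedge_inr x0 y0 ` topspace Y"
      unfolding topspace_wedge_topology by blast
    then show "openin ?W {w \<in> topspace ?W. h w \<in> V}"
      unfolding openin_wedge_topology eq
      using openin_continuous_map_preimage[OF 1 V] openin_continuous_map_preimage[OF 2 V] by blast
  qed
  have closed: "closed_map ?W ?P h"
    unfolding closed_map_def
  proof (intro allI impI)
    fix C assume C: "closedin ?W C"
    let ?A = "{x \<in> topspace X. Inl x \<in> C}" and ?B = "{y \<in> topspace Y. wedge_inr x0 y0 y \<in> C}"
    have op: "openin ?W (topspace ?W - C)" and sub: "C \<subseteq> topspace ?W"
      using C by (auto simp: closedin_def)
    have "{x \<in> topspace X. Inl x \<in> topspace ?W - C} = topspace X - ?A"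
      "{y \<in> topspace Y. wedge_inr x0 y0 y \<in> topspace ?W - C} = topspace Y - ?B"
      by (auto simp: topspace_wedge_topology)
    then have "closedin X ?A" "closedin Y ?B"
      using op unfolding openin_wedge_topology closedin_def by auto
    moreover have "h ` C = ?A \<times> {y0} \<union> {x0} \<times> ?B"
    proof
      show "h ` C \<subseteq> ?A \<times> {y0} \<union> {x0} \<times> ?B"
        using sub by (force simp: topspace_wedge_topology h_inl h_inr)
      show "?A \<times> {y0} \<union> {x0} \<times> ?B \<subseteq> h ` C"
        by (auto simp: image_iff) (metis h_inl, metis h_inr)
    qed
    ultimately show "closedin ?P (h ` C)"
      using clX clY by (auto intro!: closedin_Un simp: closedin_prod_Times_iff)
  qed
  have "inj_on h (topspace ?W)"
    by (auto simp: inj_on_def topspace_wedge_topology h_inl h_inr wedge_inr_def h_def)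
  then have "?W homeomorphic_space subtopology ?P (h ` topspace ?W)"
    using cont closed injective_closed_imp_embedding_map embedding_map_imp_homeomorphic_space
    by blast
  moreover have "metrizable_space ?P"
    using assms by (simp add: metrizable_space_prod_topology)
  ultimately show ?thesis
    using homeomorphic_metrizable_space metrizable_space_subtopology by blast
qed

section \<open>Finitely supported probability measures\<close>

text \<open>
  A finite convex combination of points is a \<open>pmf\<close> with finite support; \<open>return_pmf z\<close> is the Dirac
  measure at \<open>z\<close>. Finiteness is required separately because infinite sets have \<open>card\<close> 0.
\<close>

definition fin_prob :: "nat \<Rightarrow> 'a set \<Rightarrow> 'a pmf set" where
  "fin_prob n Z = {p. set_pmf p \<subseteq> Z \<and> finite (set_pmf p) \<and> card (set_pmf p) \<le> n}"

definition borel_sets :: "'a metric \<Rightarrow> 'a set set" where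
  "borel_sets Z = sigma_sets (mspace Z) {U. openin (mtopology_of Z) U}"

definition thicken :: "'a metric \<Rightarrow> real \<Rightarrow> 'a set \<Rightarrow> 'a set" where
  "thicken Z e A = (\<Union>a\<in>A. mball_of Z a e)"

text \<open>The Levy--Prokhorov distance is the infimum of \<open>LP_set\<close>.\<close>

definition LP_set :: "'a metric \<Rightarrow> 'a pmf \<Rightarrow> 'a pmf \<Rightarrow> real set" where
  "LP_set Z p q = {e. e > 0 \<and> (\<forall>A\<in>borel_sets Z.
     measure_pmf.prob p A \<le> measure_pmf.prob q (thicken Z e A) + e \<and>
     measure_pmf.prob q A \<le> measure_pmf.prob p (thicken Z e A) + e)}"

definition LP_dist :: "'a metric \<Rightarrow> 'a pmf \<Rightarrow> 'a pmf \<Rightarrow> real" where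
  "LP_dist Z p q = Inf (LP_set Z p q)"

definition B_metric :: "nat \<Rightarrow> 'a metric \<Rightarrow> 'a pmf metric" where
  "B_metric n Z = metric (fin_prob n (mspace Z), LP_dist Z)"

lemma one_in_LP_set: "1 \<in> LP_set Z p q"
  by (auto simp: LP_set_def intro!: order_trans[OF measure_pmf.prob_le_1])

lemma LP_dist_nonneg: "0 \<le> LP_dist Z p q"
  unfolding LP_dist_def
proof (rule cInf_greatest)
  show "LP_set Z p q \<noteq> {}" using one_in_LP_set by blast
qed (simp add: LP_set_def)

lemma bdd_below_LP_set: "bdd_below (LP_set Z p q)"
  by (rule bdd_belowI[where m = 0]) (auto simp: LP_set_def)

lemma borel_sets_open: "openin (mtopology_of Z) U \<Longrightarrow> U \<in> borel_sets Z"
  by (auto simp: borel_sets_def)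

lemma openin_thicken: "openin (mtopology_of Z) (thicken Z e A)"
  by (auto simp: thicken_def mtopology_of_def mball_of_def
      intro!: openin_Union Metric_space.openin_mball)

lemma singleton_in_borel_sets:
  assumes "z \<in> mspace Z" shows "{z} \<in> borel_sets Z"
proof -
  have "closedin (mtopology_of Z) {z}"
    using assms by (intro closedin_Hausdorff_singleton)
      (auto simp: mtopology_of_def Metric_space.Hausdorff_space_mtopology Metric_space.topspace_mtopology)
  then have "openin (mtopology_of Z) (mspace Z - {z})"
    by (simp add: closedin_def)
  then have "mspace Z - (mspace Z - {z}) \<in> borel_sets Z"
    unfolding borel_sets_def by (auto intro: sigma_sets.intros)
  with assms show ?thesis by (simp add: Diff_Diff_Int)
qed

lemma LP_set_less:
  assumes "LP_dist Z p q < e"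
  obtains e' where "e' \<in> LP_set Z p q" "e' < e"
  using assms one_in_LP_set[of Z p q] bdd_below_LP_set[of Z p q]
  by (metis LP_dist_def cInf_less_iff empty_iff)

lemma thicken_mono: "e \<le> e' \<Longrightarrow> thicken Z e A \<subseteq> thicken Z e' A"
  by (force simp: thicken_def)

lemma prob_thicken_mono:
  "e \<le> e' \<Longrightarrow> measure_pmf.prob p (thicken Z e A) \<le> measure_pmf.prob p (thicken Z e' A)"
  by (rule measure_pmf.finite_measure_mono) (auto dest: thicken_mono)

lemma thicken_thicken: "thicken Z e (thicken Z e' A) \<subseteq> thicken Z (e + e') A"
proof
  fix z assume "z \<in> thicken Z e (thicken Z e' A)"
  then obtain a b where "a \<in> A" "b \<in> mball_of Z a e'" "z \<in> mball_of Z b e"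
    by (auto simp: thicken_def)
  then have "z \<in> mball_of Z a (e + e')"
    using mdist_triangle[of a Z b z] by auto
  with \<open>a \<in> A\<close> show "z \<in> thicken Z (e + e') A" by (auto simp: thicken_def)
qed

lemma LP_dist_zero_imp_le:
  assumes p: "p \<in> fin_prob n (mspace Z)" and q: "q \<in> fin_prob n (mspace Z)"
    and 0: "LP_dist Z p q = 0" and z: "z \<in> mspace Z"
  shows "pmf p z \<le> pmf q z"
proof (rule field_le_epsilon)
  fix e :: real assume e: "e > 0"
  define d where "d = Min (insert e (mdist Z z ` (set_pmf q - {z})))"
  have fin: "finite (set_pmf q)" and sub: "set_pmf q \<subseteq> mspace Z"
    using q by (auto simp: fin_prob_def)
  have "d > 0"
    unfolding d_def using fin sub z e
    by (subst Min_gr_iff) (auto simp: order_less_le)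
  then obtain e' where e': "e' \<in> LP_set Z p q" "e' < d"
    using LP_set_less 0 by metis
  have far: "w \<notin> thicken Z e' {z}" if "w \<in> set_pmf q" "w \<noteq> z" for w
  proof -
    have "d \<le> mdist Z z w"
      unfolding d_def using that fin by (intro Min_le) auto
    with e' show ?thesis by (auto simp: thicken_def)
  qed
  have "d \<le> e" unfolding d_def using fin by (intro Min_le) auto
  have "pmf p z = measure_pmf.prob p {z}" by (simp add: measure_pmf_single)
  also have "\<dots> \<le> measure_pmf.prob q (thicken Z e' {z}) + e'"
    using e' singleton_in_borel_sets[OF z] by (auto simp: LP_set_def)
  also have "measure_pmf.prob q (thicken Z e' {z})
      = measure_pmf.prob q (thicken Z e' {z} \<inter> set_pmf q)"
    by (simp add: measure_Int_set_pmf)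
  also have "\<dots> \<le> measure_pmf.prob q {z}"
    using far by (intro measure_pmf.finite_measure_mono) auto
  also have "\<dots> = pmf q z" by (simp add: measure_pmf_single)
  finally show "pmf p z \<le> pmf q z + e" using e' \<open>d \<le> e\<close> by linarith
qed

lemma LP_dist_commute: "LP_dist Z p q = LP_dist Z q p"
proof -
  have "LP_set Z p q = LP_set Z q p" by (auto simp: LP_set_def)
  then show ?thesis by (simp add: LP_dist_def)
qed

lemma LP_dist_self:
  assumes "set_pmf p \<subseteq> mspace Z" shows "LP_dist Z p p = 0"
proof -
  have *: "e \<in> LP_set Z p p" if "e > 0" for e
  proof -
    have "measure_pmf.prob p A \<le> measure_pmf.prob p (thicken Z e A)" if "A \<in> borel_sets Z" for A
    proof (rule measure_pmf.finite_measure_mono)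
      have "A \<subseteq> mspace Z"
        using that unfolding borel_sets_def
        by (metis (mono_tags, lifting) CollectD Pow_iff openin_subset sigma_sets_into_sp subsetI
            topspace_mtopology_of)
      then have "a \<in> mball_of Z a e" if "a \<in> A" for a
        using that \<open>e > 0\<close> by (metis in_mball_of mdist_zero subsetD)
      then show "A \<subseteq> thicken Z e A" unfolding thicken_def by blast
    qed simp
    with \<open>e > 0\<close> show ?thesis by (fastforce simp: LP_set_def)
  qed
  have "LP_dist Z p p \<le> e" if "e > 0" for e
    unfolding LP_dist_def using * that bdd_below_LP_set by (intro cInf_lower)
  then show ?thesis using LP_dist_nonneg[of Z p p] by (metis dense not_le order_le_less)
qed

lemma LP_dist_triangle: "LP_dist Z p r \<le> LP_dist Z p q + LP_dist Z q r"
proof (rule field_le_epsilon)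
  fix e :: real assume "e > 0"
  then obtain a b where a: "a \<in> LP_set Z p q" "a < LP_dist Z p q + e / 2"
    and b: "b \<in> LP_set Z q r" "b < LP_dist Z q r + e / 2"
    using LP_set_less[of Z p q "LP_dist Z p q + e / 2"] LP_set_less[of Z q r "LP_dist Z q r + e / 2"]
    by (metis half_gt_zero less_add_same_cancel1)
  have step: "measure_pmf.prob p A \<le> measure_pmf.prob r (thicken Z (a + b) A) + (a + b)"
    if "\<And>A. A \<in> borel_sets Z \<Longrightarrow> measure_pmf.prob p A \<le> measure_pmf.prob q (thicken Z a A) + a"
       "\<And>A. A \<in> borel_sets Z \<Longrightarrow> measure_pmf.prob q A \<le> measure_pmf.prob r (thicken Z b A) + b"
       "A \<in> borel_sets Z" for p q r :: "'a pmf" and a b A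
  proof -
    have "measure_pmf.prob r (thicken Z b (thicken Z a A)) \<le> measure_pmf.prob r (thicken Z (a + b) A)"
      using thicken_thicken[of Z b a A]
      by (intro measure_pmf.finite_measure_mono) (auto simp: add.commute)
    then show ?thesis
      using that(1)[OF that(3)] that(2)[OF borel_sets_open[OF openin_thicken, of Z a A]] by linarith
  qed
  have "a + b \<in> LP_set Z p r"
    using a(1) b(1) step[of p q a r b] step[of r q b p a]
    by (auto simp: LP_set_def add.commute)
  then have "LP_dist Z p r \<le> a + b"
    unfolding LP_dist_def using bdd_below_LP_set by (intro cInf_lower)
  with a b show "LP_dist Z p r \<le> LP_dist Z p q + LP_dist Z q r + e" by linarith
qed

lemma Metric_space_LP: "Metric_space (fin_prob n (mspace Z)) (LP_dist Z)"
proof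
  fix p q :: "'a pmf"
  show "0 \<le> LP_dist Z p q" by (rule LP_dist_nonneg)
  show "LP_dist Z p q = LP_dist Z q p" by (rule LP_dist_commute)
  assume p: "p \<in> fin_prob n (mspace Z)" and q: "q \<in> fin_prob n (mspace Z)"
  show "LP_dist Z p q = 0 \<longleftrightarrow> p = q"
  proof
    assume 0: "LP_dist Z p q = 0"
    show "p = q"
    proof (rule pmf_eqI)
      fix z
      show "pmf p z = pmf q z"
      proof (cases "z \<in> mspace Z")
        case True
        then show ?thesis
          using LP_dist_zero_imp_le[OF p q 0] LP_dist_zero_imp_le[OF q p] 0 LP_dist_commute
          by (metis order_antisym)
      next
        case False
        then have "z \<notin> set_pmf p" "z \<notin> set_pmf q" using p q by (auto simp: fin_prob_def)
        then show ?thesis by (simp add: set_pmf_iff)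
      qed
    qed
  next
    assume "p = q"
    then show "LP_dist Z p q = 0" using p by (auto simp: fin_prob_def LP_dist_self)
  qed
qed (rule LP_dist_triangle)

lemma mspace_B_metric: "mspace (B_metric n Z) = fin_prob n (mspace Z)"
  and mdist_B_metric: "mdist (B_metric n Z) = LP_dist Z"
  unfolding B_metric_def
  by (simp_all add: Metric_space.mspace_metric Metric_space.mdist_metric Metric_space_LP)

section \<open>Path spaces\<close>

text \<open>A path is represented by the function that is \<open>undefined\<close> outside the unit interval.\<close>

definition paths :: "'a topology \<Rightarrow> (real \<Rightarrow> 'a) set" where
  "paths Z = {f \<in> extensional {0..1}. continuous_map (top_of_set {0..1}) Z f}"

text \<open>The compact-open topology:\<close>

definition path_space :: "'a topology \<Rightarrow> (real \<Rightarrow> 'a) topology" where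
  "path_space Z = topology_generated_by
     {{f \<in> paths Z. f ` K \<subseteq> U} | K U. compact K \<and> K \<subseteq> {0..1} \<and> openin Z U}"

lemma topspace_path_space: "topspace (path_space Z) = paths Z"
proof -
  have "paths Z \<in> {{f \<in> paths Z. f ` K \<subseteq> U} | K U. compact K \<and> K \<subseteq> {0..1} \<and> openin Z U}"
    by (intro CollectI exI[of _ "{}"]) auto
  then show ?thesis unfolding path_space_def topology_generated_by_topspace by blast
qed

section \<open>Resolvable paths and the invariant \<open>iTC\<close>\<close>

definition Phi :: "(real \<Rightarrow> 'a) pmf \<Rightarrow> real \<Rightarrow> 'a pmf" where
  "Phi \<mu> = (\<lambda>t\<in>{0..1}. map_pmf (\<lambda>\<alpha>. \<alpha> t) \<mu>)"

text \<open>
  As a set, the space of measures on paths does not depend on a metric on the path space, and only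
  the set is needed to say which paths are resolvable.
\<close>

definition resolvable_space :: "nat \<Rightarrow> 'a metric \<Rightarrow> (real \<Rightarrow> 'a pmf) topology" where
  "resolvable_space n Z = subtopology (path_space (mtopology_of (B_metric n Z)))
     (Phi ` fin_prob n (paths (mtopology_of Z)))"

text \<open>
  The power \<open>X\<^sup>m\<close> is the product topology on extensional functions on \<open>{1..m}\<close>. The infimum of the
  empty set is \<open>\<infinity>\<close>. The space is given with a metric because the Levy--Prokhorov distance refers
  to one; statements about wedges and products range over all metrics inducing the topology.
\<close>

definition iTC :: "nat \<Rightarrow> 'a metric \<Rightarrow> enat" where
  "iTC m X = (INF n \<in> {n. \<exists>s.
       continuous_map (product_topology (\<lambda>_. mtopology_of X) {1..m}) (resolvable_space (n + 1) X) s \<and>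
       (\<forall>x \<in> {1..m} \<rightarrow>\<^sub>E mspace X. \<forall>i \<in> {1..m}.
          s x ((real i - 1) / (real m - 1)) = return_pmf (x i))}. enat n)"

end

theory Submission
  imports Defs
begin

text \<open>
  Both \<open>X\<close> and \<open>Y\<close> are retracts of \<open>X \<or> Y\<close> (collapse the other summand) and of \<open>X \<times> Y\<close> (project).
  So the claim follows once \<open>iTC m\<close> is monotone under retracts (\<open>iTC_retraction_maps_le\<close>). Let
  \<open>r : W \<rightarrow> X\<close> be a retraction with section \<open>i\<close>. A resolvable motion planner \<open>s\<close> on \<open>W\<close> yields the
  planner \<open>x \<mapsto> (t \<mapsto> r\<^sub>* (s (i \<circ> x) t))\<close> on \<open>X\<close>, where \<open>r\<^sub>*\<close> pushes measures forward. It passes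
  through the Dirac measures at \<open>r (i x\<^sub>j) = x\<^sub>j\<close>, and it is resolved by the pushforward of the
  resolving measure along \<open>\<alpha> \<mapsto> r \<circ> \<alpha>\<close>, whose support has no more points than the original one.

  The analytic content is that \<open>r\<^sub>*\<close> is continuous for the Levy--Prokhorov metrics although \<open>r\<close> need
  not be uniformly continuous (\<open>continuous_map_map_pmf\<close>). It holds because the measures have
  finite support, so that continuity of \<open>r\<close> at finitely many points is enough.
\<close>

section \<open>Pushing finitely supported measures forward\<close>

text \<open>
  One of the two inequalities in the Levy--Prokhorov condition implies the other: apply it to the
  complement of the thickening of \<open>A\<close>, whose own thickening is disjoint from \<open>A\<close>.
\<close>

lemma LP_setI_one_sided:
  assumes "e > 0" and p: "set_pmf p \<subseteq> mspace Z"
    and le: "\<And>A. A \<in> borel_sets Z \<Longrightarrow>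
      measure_pmf.prob p A \<le> measure_pmf.prob q (thicken Z e A) + e"
  shows "e \<in> LP_set Z p q"
proof -
  have "measure_pmf.prob q A \<le> measure_pmf.prob p (thicken Z e A) + e" for A
  proof -
    let ?B = "mspace Z - thicken Z e A"
    have B: "?B \<in> borel_sets Z"
      using borel_sets_open[OF openin_thicken] unfolding borel_sets_def
      by (rule sigma_sets.Compl)
    have "1 = measure_pmf.prob p (?B \<union> thicken Z e A)"
      using p by (intro measure_pmf.prob_eq_1[THEN iffD2, symmetric]) (auto simp: AE_measure_pmf_iff)
    also have "\<dots> = measure_pmf.prob p ?B + measure_pmf.prob p (thicken Z e A)"
      by (intro measure_pmf.finite_measure_Union) auto
    finally have p1: "1 = measure_pmf.prob p ?B + measure_pmf.prob p (thicken Z e A)" .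
    have "A \<inter> thicken Z e ?B = {}"
      by (auto simp: thicken_def mdist_commute)
    then have "measure_pmf.prob q A + measure_pmf.prob q (thicken Z e ?B)
        = measure_pmf.prob q (A \<union> thicken Z e ?B)"
      by (intro measure_pmf.finite_measure_Union[symmetric]) auto
    also have "\<dots> \<le> 1" by simp
    finally show ?thesis using p1 le[OF B] by linarith
  qed
  then show ?thesis using \<open>e > 0\<close> le by (auto simp: LP_set_def)
qed

lemma map_pmf_in_fin_prob:
  assumes "p \<in> fin_prob n A" and "f ` A \<subseteq> B"
  shows "map_pmf f p \<in> fin_prob n B"
  using assms by (auto simp: fin_prob_def intro: order_trans[OF card_image_le])

lemma finite_subset_in_borel_sets:
  assumes "finite F" and "F \<subseteq> mspace Z"
  shows "F \<in> borel_sets Z"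
  using assms
proof (induction F)
  case empty
  then show ?case by (simp add: borel_sets_def sigma_sets.Empty)
next
  case (insert z F)
  have sub: "{U. openin (mtopology_of Z) U} \<subseteq> Pow (mspace Z)"
    using openin_subset by fastforce
  have "{z} \<union> F \<in> borel_sets Z"
    using insert singleton_in_borel_sets[of z Z] unfolding borel_sets_def
    by (intro sigma_sets_Un) auto
  then show ?case by simp
qed

lemma continuous_map_mtopology_of_iff:
  "continuous_map (mtopology_of Z) (mtopology_of Z') f \<longleftrightarrow>
     f ` mspace Z \<subseteq> mspace Z' \<and>
     (\<forall>a\<in>mspace Z. \<forall>e>0. \<exists>d>0. \<forall>x. x \<in> mspace Z \<and> mdist Z a x < d \<longrightarrow> mdist Z' (f a) (f x) < e)"
  unfolding mtopology_of_def
  by (rule Metric_space.metric_continuous_map) auto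

text \<open>
  At a measure \<open>p\<close>, a Borel set \<open>A\<close> can be replaced by the finite set \<open>F\<close> of support points of \<open>p\<close>
  that \<open>g\<close> sends into \<open>A\<close>. If \<open>d\<close> is a modulus of continuity of \<open>g\<close> at the finitely many support
  points, then the \<open>d\<close>-thickening of \<open>F\<close> is mapped into the \<open>e\<close>-thickening of \<open>A\<close>.
\<close>

lemma continuous_map_map_pmf:
  assumes g: "continuous_map (mtopology_of Z) (mtopology_of Z') g"
  shows "continuous_map (mtopology_of (B_metric n Z)) (mtopology_of (B_metric n Z')) (map_pmf g)"
  unfolding continuous_map_mtopology_of_iff mspace_B_metric mdist_B_metric
proof (intro conjI ballI allI impI)
  have g_into: "g ` mspace Z \<subseteq> mspace Z'"
    using g by (auto simp: continuous_map_mtopology_of_iff)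
  then show "map_pmf g ` fin_prob n (mspace Z) \<subseteq> fin_prob n (mspace Z')"
    by (auto intro: map_pmf_in_fin_prob)
  fix p and e' :: real
  assume p: "p \<in> fin_prob n (mspace Z)" and "e' > 0"
  \<comment> \<open>Membership of \<open>e\<close> in \<open>LP_set\<close> only gives distance at most \<open>e\<close>, hence the factor 1/2.\<close>
  define e where "e = e' / 2"
  have "e > 0" "e < e'" using \<open>e' > 0\<close> by (auto simp: e_def)
  have fin: "finite (set_pmf p)" and sub: "set_pmf p \<subseteq> mspace Z"
    using p by (auto simp: fin_prob_def)
  have "\<forall>a\<in>set_pmf p. \<exists>d>0. \<forall>x. x \<in> mspace Z \<and> mdist Z a x < d \<longrightarrow> mdist Z' (g a) (g x) < e"
    using g sub \<open>e > 0\<close> by (auto simp: continuous_map_mtopology_of_iff)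
  then obtain D where D: "\<And>a. a \<in> set_pmf p \<Longrightarrow> D a > 0"
      "\<And>a x. a \<in> set_pmf p \<Longrightarrow> x \<in> mspace Z \<Longrightarrow> mdist Z a x < D a \<Longrightarrow> mdist Z' (g a) (g x) < e"
    by metis
  define d where "d = Min (insert e (D ` set_pmf p))"
  have "d > 0" using fin D(1) \<open>e > 0\<close> by (auto simp: d_def)
  have "d \<le> e" using fin by (auto simp: d_def)
  have d_le: "d \<le> D a" if "a \<in> set_pmf p" for a
    using fin that by (auto simp: d_def intro: Min_le)
  show "\<exists>d>0. \<forall>q. q \<in> fin_prob n (mspace Z) \<and> LP_dist Z p q < d
      \<longrightarrow> LP_dist Z' (map_pmf g p) (map_pmf g q) < e'"
  proof (intro exI conjI allI impI)
    show "d > 0" by fact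
    fix q assume q: "q \<in> fin_prob n (mspace Z) \<and> LP_dist Z p q < d"
    then obtain c where c: "c \<in> LP_set Z p q" "c < d" using LP_set_less by blast
    have "e \<in> LP_set Z' (map_pmf g p) (map_pmf g q)"
    proof (rule LP_setI_one_sided)
      show "e > 0" by fact
      show "set_pmf (map_pmf g p) \<subseteq> mspace Z'" using sub g_into by auto
      fix A
      define F where "F = g -` A \<inter> set_pmf p"
      have "F \<in> borel_sets Z"
        using fin sub by (intro finite_subset_in_borel_sets) (auto simp: F_def)
      have thick: "thicken Z c F \<subseteq> g -` thicken Z' e A"
      proof
        fix x assume "x \<in> thicken Z c F"
        then obtain a where a: "a \<in> set_pmf p" "g a \<in> A" "x \<in> mspace Z" "mdist Z a x < c"
          by (auto simp: thicken_def F_def)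
        then have "mdist Z' (g a) (g x) < e"
          using D(2)[of a x] d_le[of a] \<open>c < d\<close> by linarith
        then show "x \<in> g -` thicken Z' e A"
          using a sub g_into by (auto simp: thicken_def intro!: bexI[of _ "g a"])
      qed
      have "measure_pmf.prob (map_pmf g p) A = measure_pmf.prob p F"
        by (simp add: F_def measure_Int_set_pmf)
      also have "\<dots> \<le> measure_pmf.prob q (thicken Z c F) + c"
        using c \<open>F \<in> borel_sets Z\<close> by (auto simp: LP_set_def)
      also have "measure_pmf.prob q (thicken Z c F) \<le> measure_pmf.prob q (g -` thicken Z' e A)"
        using thick by (intro measure_pmf.finite_measure_mono) auto
      also have "\<dots> = measure_pmf.prob (map_pmf g q) (thicken Z' e A)"
        by simp
      finally show "measure_pmf.prob (map_pmf g p) A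
          \<le> measure_pmf.prob (map_pmf g q) (thicken Z' e A) + e"
        using c \<open>d \<le> e\<close> by linarith
    qed
    then have "LP_dist Z' (map_pmf g p) (map_pmf g q) \<le> e"
      unfolding LP_dist_def using bdd_below_LP_set by (intro cInf_lower)
    then show "LP_dist Z' (map_pmf g p) (map_pmf g q) < e'" using \<open>e < e'\<close> by linarith
  qed
qed

section \<open>Pushing paths and resolvable paths forward\<close>

lemma paths_compose:
  assumes "continuous_map Z Z' g" and "f \<in> paths Z"
  shows "(\<lambda>t\<in>{0..1}. g (f t)) \<in> paths Z'"
proof -
  have "continuous_map (top_of_set {0..1}) Z' (g \<circ> f)"
    using assms by (auto simp: paths_def intro: continuous_map_compose)
  then have "continuous_map (top_of_set {0..1}) Z' (\<lambda>t\<in>{0..1}. g (f t))"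
    by (rule continuous_map_eq) auto
  then show ?thesis by (simp add: paths_def)
qed

lemma continuous_map_path_space:
  assumes g: "continuous_map Z Z' g"
  shows "continuous_map (path_space Z) (path_space Z') (\<lambda>f. \<lambda>t\<in>{0..1}. g (f t))"
proof -
  let ?G = "\<lambda>f. \<lambda>t\<in>{0..1::real}. g (f t)"
  let ?S = "\<lambda>Z. {{f \<in> paths Z. f ` K \<subseteq> U} | K U. compact K \<and> K \<subseteq> {0..1} \<and> openin Z U}"
  have "openin (path_space Z) (?G -` V \<inter> topspace (path_space Z))" if V_in: "V \<in> ?S Z'" for V
  proof -
    obtain K U where V: "V = {f \<in> paths Z'. f ` K \<subseteq> U}"
      and K: "compact K" "K \<subseteq> {0..1}" and U: "openin Z' U"
      using V_in by blast
    let ?U = "{z \<in> topspace Z. g z \<in> U}"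
    have into: "f t \<in> topspace Z" if "f \<in> paths Z" "t \<in> K" for f t
      using that K by (auto simp: paths_def continuous_map_def Pi_iff)
    have "?G -` V \<inter> topspace (path_space Z) = {f \<in> paths Z. f ` K \<subseteq> ?U}"
      using K(2) paths_compose[OF g] into
      by (auto simp: V topspace_path_space image_subset_iff subset_iff)
    moreover have "{f \<in> paths Z. f ` K \<subseteq> ?U} \<in> ?S Z"
      using K openin_continuous_map_preimage[OF g U] by blast
    ultimately show ?thesis
      unfolding path_space_def by (metis (no_types, lifting) topology_generated_by_Basis)
  qed
  moreover have "?G ` topspace (path_space Z) \<subseteq> \<Union> (?S Z')"
    using paths_compose[OF g] topspace_path_space[of Z] topspace_path_space[of Z']
    unfolding path_space_def topology_generated_by_topspace by blast
  ultimately show ?thesis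
    unfolding path_space_def[of Z'] by (intro continuous_on_generated_topo)
qed

text \<open>
  The pushforward of a resolvable path is resolvable because \<open>Phi\<close> is natural: evaluation at \<open>t\<close>
  commutes with applying \<open>g\<close>.
\<close>

lemma continuous_map_resolvable_space:
  assumes g: "continuous_map (mtopology_of Z) (mtopology_of Z') g"
  shows "continuous_map (resolvable_space n Z) (resolvable_space n Z')
    (\<lambda>f. \<lambda>t\<in>{0..1}. map_pmf g (f t))"
  unfolding resolvable_space_def
proof (rule continuous_map_into_subtopology)
  let ?G = "\<lambda>f. \<lambda>t\<in>{0..1::real}. map_pmf g (f t)"
  let ?R = "\<lambda>Z. Phi ` fin_prob n (paths (mtopology_of Z))"
  show "continuous_map
      (subtopology (path_space (mtopology_of (B_metric n Z))) (?R Z))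
      (path_space (mtopology_of (B_metric n Z'))) ?G"
    by (intro continuous_map_from_subtopology continuous_map_path_space continuous_map_map_pmf g)
  have "?G (Phi \<mu>) \<in> ?R Z'" if "\<mu> \<in> fin_prob n (paths (mtopology_of Z))" for \<mu>
  proof
    show "map_pmf (\<lambda>\<alpha>. \<lambda>t\<in>{0..1}. g (\<alpha> t)) \<mu> \<in> fin_prob n (paths (mtopology_of Z'))"
      using that paths_compose[OF g] by (intro map_pmf_in_fin_prob[OF that]) blast
    show "?G (Phi \<mu>) = Phi (map_pmf (\<lambda>\<alpha>. \<lambda>t\<in>{0..1}. g (\<alpha> t)) \<mu>)"
      by (auto simp: Phi_def pmf.map_comp o_def fun_eq_iff)
  qed
  then show "?G \<in> topspace (subtopology (path_space (mtopology_of (B_metric n Z))) (?R Z)) \<rightarrow> ?R Z'"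
    by (auto simp: Pi_iff)
qed

section \<open>Monotonicity under retracts\<close>

lemma continuous_map_power:
  assumes g: "continuous_map Z Z' g"
  shows "continuous_map (product_topology (\<lambda>_. Z) I) (product_topology (\<lambda>_. Z') I)
    (\<lambda>x. \<lambda>j\<in>I. g (x j))"
proof -
  have "continuous_map (product_topology (\<lambda>_. Z) I) Z' (\<lambda>x. g (x j))" if "j \<in> I" for j
    using continuous_map_compose[OF continuous_map_product_projection[OF that] g]
    by (simp add: o_def)
  then show ?thesis by (auto simp: continuous_map_componentwise)
qed

text \<open>
  The hypothesis \<open>m \<ge> 2\<close> guarantees that the times \<open>(i - 1) / (m - 1)\<close> lie in the unit interval,
  outside which paths carry no information.
\<close>

lemma iTC_retraction_maps_le:
  assumes m: "m \<ge> 2" and ret: "retraction_maps (mtopology_of W) (mtopology_of X) r i"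
  shows "iTC m X \<le> iTC m W"
  unfolding iTC_def
proof (rule INF_superset_mono)
  have r: "continuous_map (mtopology_of W) (mtopology_of X) r"
    and i: "continuous_map (mtopology_of X) (mtopology_of W) i"
    and ri: "\<And>x. x \<in> mspace X \<Longrightarrow> r (i x) = x"
    using ret by (auto simp: retraction_maps_def)
  have i_into: "i x \<in> mspace W" if "x \<in> mspace X" for x
    using i that by (auto simp: continuous_map_def Pi_iff)
  let ?planner = "\<lambda>(n::nat) Z s.
       continuous_map (product_topology (\<lambda>_. mtopology_of Z) {1..m}) (resolvable_space (n + 1) Z) s \<and>
       (\<forall>x \<in> {1..m} \<rightarrow>\<^sub>E mspace Z. \<forall>i \<in> {1..m}.
          s x ((real i - 1) / (real m - 1)) = return_pmf (x i))"
  have "\<exists>s'. ?planner n X s'" if s: "?planner n W s" for n s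
  proof (intro exI conjI ballI)
    let ?I = "\<lambda>x. \<lambda>j\<in>{1..m}. i (x j)"
    let ?s = "(\<lambda>f. \<lambda>t\<in>{0..1}. map_pmf r (f t)) \<circ> (s \<circ> ?I)"
    show "continuous_map (product_topology (\<lambda>_. mtopology_of X) {1..m}) (resolvable_space (n + 1) X) ?s"
      using s by (intro continuous_map_compose[OF _ continuous_map_resolvable_space[OF r]]
          continuous_map_compose[OF continuous_map_power[OF i]]) auto
    fix x k assume x: "x \<in> {1..m} \<rightarrow>\<^sub>E mspace X" and k: "k \<in> {1..m}"
    let ?t = "(real k - 1) / (real m - 1)"
    have "?t \<in> {0..1}" using k m by (auto simp: divide_simps)
    moreover have "?I x \<in> {1..m} \<rightarrow>\<^sub>E mspace W" using x i_into by auto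
    then have "s (?I x) ?t = return_pmf (?I x k)" using s k by blast
    moreover have "r (i (x k)) = x k" using ri PiE_mem[OF x k] by simp
    ultimately show "?s x ?t = return_pmf (x k)" using k by simp
  qed
  then show "{n. \<exists>s. ?planner n W s} \<subseteq> {n. \<exists>s. ?planner n X s}" by blast
qed simp

section \<open>Wedge and product retract onto their factors\<close>

lemma continuous_map_wedge_Inl:
  "continuous_map X (wedge_topology X x0 Y y0) Inl"
  by (auto simp: continuous_map_def openin_wedge_topology topspace_wedge_topology)

lemma continuous_map_wedge_inr:
  "continuous_map Y (wedge_topology X x0 Y y0) (wedge_inr x0 y0)"
  by (auto simp: continuous_map_def openin_wedge_topology topspace_wedge_topology)

lemma continuous_map_from_wedge:
  assumes inl: "continuous_map X Z (\<lambda>x. h (Inl x))"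
    and inr: "continuous_map Y Z (\<lambda>y. h (wedge_inr x0 y0 y))"
  shows "continuous_map (wedge_topology X x0 Y y0) Z h"
  unfolding continuous_map_def
proof (intro conjI allI impI)
  show "h \<in> topspace (wedge_topology X x0 Y y0) \<rightarrow> topspace Z"
    using inl inr by (auto simp: topspace_wedge_topology continuous_map_def Pi_iff)
  fix U assume U: "openin Z U"
  let ?V = "{w \<in> topspace (wedge_topology X x0 Y y0). h w \<in> U}"
  have "{x \<in> topspace X. Inl x \<in> ?V} = {x \<in> topspace X. h (Inl x) \<in> U}"
    "{y \<in> topspace Y. wedge_inr x0 y0 y \<in> ?V} = {y \<in> topspace Y. h (wedge_inr x0 y0 y) \<in> U}"
    by (auto simp: topspace_wedge_topology)
  moreover have "?V \<subseteq> Inl ` topspace X \<union> wedge_inr x0 y0 ` topspace Y"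
    unfolding topspace_wedge_topology by blast
  ultimately show "openin (wedge_topology X x0 Y y0) ?V"
    unfolding openin_wedge_topology
    using openin_continuous_map_preimage[OF inl U] openin_continuous_map_preimage[OF inr U]
    by metis
qed

lemma retraction_maps_wedge_left:
  assumes "x0 \<in> topspace X"
  shows "retraction_maps (wedge_topology X x0 Y y0) X (case_sum (\<lambda>x. x) (\<lambda>_. x0)) Inl"
proof -
  have "(\<lambda>y. case_sum (\<lambda>x. x) (\<lambda>_. x0) (wedge_inr x0 y0 y)) = (\<lambda>_. x0)"
    by (auto simp: wedge_inr_def)
  then show ?thesis
    using assms by (auto simp: retraction_maps_def intro!: continuous_map_from_wedge continuous_map_wedge_Inl)
qed

lemma retraction_maps_wedge_right:
  assumes "y0 \<in> topspace Y"
  shows "retraction_maps (wedge_topology X x0 Y y0) Y (case_sum (\<lambda>_. y0) (\<lambda>y. y)) (wedge_inr x0 y0)"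
proof -
  have eq: "case_sum (\<lambda>_. y0) (\<lambda>y. y) (wedge_inr x0 y0 y) = y" for y
    by (auto simp: wedge_inr_def)
  then show ?thesis
    using assms by (auto simp: retraction_maps_def intro!: continuous_map_from_wedge continuous_map_wedge_inr)
qed

lemma retraction_maps_prod_fst:
  assumes "y0 \<in> topspace Y"
  shows "retraction_maps (prod_topology X Y) X fst (\<lambda>x. (x, y0))"
  using assms by (auto simp: retraction_maps_def intro!: continuous_map_pairedI continuous_map_fst)

lemma retraction_maps_prod_snd:
  assumes "x0 \<in> topspace X"
  shows "retraction_maps (prod_topology X Y) Y snd (\<lambda>y. (x0, y))"
  using assms by (auto simp: retraction_maps_def intro!: continuous_map_pairedI continuous_map_snd)

theorem corollary4p5:
  fixes m :: nat
    and X :: "'a metric" and Y :: "'b metric"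
    and W :: "('a + 'b) metric" and P :: "('a \<times> 'b) metric"
    and x0 :: 'a and y0 :: 'b
  assumes "m \<ge> 2"
    and "ANR_space (mtopology_of X)" and "path_connected_space (mtopology_of X)"
    and "ANR_space (mtopology_of Y)" and "path_connected_space (mtopology_of Y)"
    and "x0 \<in> mspace X" and "y0 \<in> mspace Y"
    and "mtopology_of W = wedge_topology (mtopology_of X) x0 (mtopology_of Y) y0"
    and "mtopology_of P = prod_topology (mtopology_of X) (mtopology_of Y)"
  shows "max (iTC m X) (iTC m Y) \<le> min (iTC m W) (iTC m P)"
proof -
  have x0: "x0 \<in> topspace (mtopology_of X)" and y0: "y0 \<in> topspace (mtopology_of Y)"
    using assms by auto
  note W = assms(8) and P = assms(9)
  note mono = iTC_retraction_maps_le[OF \<open>m \<ge> 2\<close>]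
  have "iTC m X \<le> iTC m W" "iTC m Y \<le> iTC m W"
    using mono retraction_maps_wedge_left[OF x0] retraction_maps_wedge_right[OF y0]
    by (metis W)+
  moreover have "iTC m X \<le> iTC m P" "iTC m Y \<le> iTC m P"
    using mono retraction_maps_prod_fst[OF y0] retraction_maps_prod_snd[OF x0]
    by (metis P)+
  ultimately show ?thesis by simp
qed

end
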